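(* Let $w$ be an arbitrary word in the alphabet $\{x,D\}$, and let $x^awD^b$ be its associated Dyck word. For all integers $k \geq 0$, $$S_w(k) = {H_{x^awD^b} \brace k+b}.$$
   Context: Stirling numbers of a word. View $x$ as the operator of multiplication by the variable $x$ and $D$ as differentiation with respect to $x$, acting on infinitely differentiable functions (say on $(0,\infty)$); a word in $\{x,D\}$ is read as the composition of these operators (so $Dx = xD+1$). For every word $w$ with $m$ $x$'s and $n$ $D$'s there is a unique sequence of integers $(S_w(k))_{k\ge 0}$ (only finitely many nonzero) with $$w = x^{m-n}\sum_{k\ge 0} S_w(k)\, x^k D^k .$$ Dyck words. A word in $\{x,D\}$ is a Dyck word if it has the same number of $x$'s as $D$'s and every initial segment (reading left to right) has at least as many $x$'s as $D$'s. To a Dyck word $w$ corresponds a Dyck path in $\mathbb{R}^2$: a staircase path starting at $(0,0)$ which, reading $w$ from left to right, takes a unit step in the positive $y$ direction for each $x$ and a unit step in the positive $x$ direction for each $D$; it ends on the line $x=y$ and never goes below it. Associated Dyck word. For a word $w$ in $\{x,D\}$, let $a=a(w)$ be the least non-negative integer such that all initial segments of $x^a w$ have at least as many $x$'s as $D$'s, and let $b=b(w)$ be the unique non-negative integer such that $x^a w D^b$ is a Dyck word. Then $x^awD^b$ is the Dyck word associated with $w$. The graph $H_w$. Label each unit square of the integer grid by the coordinates of its top-right corner (so the square $[i-1,i]\times[j-1,j]$ has label $(i,j)$). For a Dyck word $w$ with $n$ $x$'s, let $\mathcal{W}_w$ be the set of labels of unit squares that lie below the Dyck path of $w$ and completely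 above the line $x=y$ (i.e. whose interior lies strictly above this line, so $i<j$). The graph $H_w$ has vertex set $\{1,\ldots,n\}$, with an edge between $i$ and $j$ ($i<j$) if and only if $(i,j)\in\mathcal{W}_w$. Graph Stirling numbers. For a graph $G$ and an integer $k\ge0$, ${G\brace k}$ is the number of partitions of the vertex set of $G$ into $k$ non-empty classes, none of which contains both endvertices of an edge of $G$. *)

theory Defs
  imports "HOL-Analysis.Analysis" "HOL-Library.Disjoint_Sets"
begin

datatype letter = X | D

type_synonym word = "letter list"

fun letter_op :: "letter \<Rightarrow> (real \<Rightarrow> real) \<Rightarrow> (real \<Rightarrow> real)" where
  "letter_op X f = (\<lambda>t. t * f t)"
| "letter_op D f = deriv f"

text \<open>The leftmost letter is the outermost operator, i.e. it is applied last.\<close>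

definition word_op :: "word \<Rightarrow> (real \<Rightarrow> real) \<Rightarrow> (real \<Rightarrow> real)" where
  "word_op w f = foldr letter_op w f"

text \<open>Infinitely differentiable functions on \<open>(0, \<infinity>)\<close>.  Such a function is represented by a
  total function whose values outside \<open>(0, \<infinity>)\<close> are irrelevant; since \<open>(0, \<infinity>)\<close> is open, these
  values do not influence derivatives at positive points.\<close>

definition smooth_on_pos :: "(real \<Rightarrow> real) \<Rightarrow> bool" where
  "smooth_on_pos f \<longleftrightarrow> (\<forall>n. (deriv ^^ n) f differentiable_on {0<..})"

definition is_stirling_seq :: "word \<Rightarrow> (nat \<Rightarrow> int) \<Rightarrow> bool" where
  "is_stirling_seq w S \<longleftrightarrow>
     finite {k. S k \<noteq> 0} \<and>
     (\<forall>f. smooth_on_pos f \<longrightarrow>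
       (\<forall>t>0. word_op w f t =
          t powi (int (count_list w X) - int (count_list w D)) *
          (\<Sum>k | S k \<noteq> 0. of_int (S k) * (t ^ k * (deriv ^^ k) f t))))"

definition word_stirling :: "word \<Rightarrow> nat \<Rightarrow> int" where
  "word_stirling w = (THE S. is_stirling_seq w S)"

definition prefix_nonneg :: "word \<Rightarrow> bool" where
  "prefix_nonneg w \<longleftrightarrow>
     (\<forall>i\<le>length w. count_list (take i w) D \<le> count_list (take i w) X)"

definition dyck_word :: "word \<Rightarrow> bool" where
  "dyck_word w \<longleftrightarrow> count_list w X = count_list w D \<and> prefix_nonneg w"

definition assoc_a :: "word \<Rightarrow> nat" where
  "assoc_a w = (LEAST a. prefix_nonneg (replicate a X @ w))"

definition assoc_b :: "word \<Rightarrow> nat" where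
  "assoc_b w = (THE b. dyck_word (replicate (assoc_a w) X @ w @ replicate b D))"

definition assoc_dyck_word :: "word \<Rightarrow> word" where
  "assoc_dyck_word w = replicate (assoc_a w) X @ w @ replicate (assoc_b w) D"

definition dyck_vertex :: "word \<Rightarrow> nat \<Rightarrow> real \<times> real" where
  "dyck_vertex w i = (real (count_list (take i w) D), real (count_list (take i w) X))"

text \<open>The initial vertex is included explicitly so that the path of the empty word is the
  point \<open>(0, 0)\<close>.\<close>

definition dyck_path :: "word \<Rightarrow> (real \<times> real) set" where
  "dyck_path w = insert (dyck_vertex w 0)
     (\<Union>i<length w. closed_segment (dyck_vertex w i) (dyck_vertex w (Suc i)))"

definition unit_square :: "nat \<Rightarrow> nat \<Rightarrow> (real \<times> real) set" where
  "unit_square i j = {real i - 1..real i} \<times> {real j - 1..real j}"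

definition below_path :: "(real \<times> real) set \<Rightarrow> (real \<times> real) set \<Rightarrow> bool" where
  "below_path Q P \<longleftrightarrow> (\<forall>(u, v)\<in>Q. \<exists>v'\<ge>v. (u, v') \<in> P)"

text \<open>Natural-number labels suffice: the path has abscissae in \<open>[0, n]\<close>, so a square below it
  has \<open>i \<ge> 1\<close>, and then lying above the diagonal forces \<open>j > i\<close>.\<close>

definition dyck_squares :: "word \<Rightarrow> (nat \<times> nat) set" where
  "dyck_squares w =
     {(i, j). below_path (unit_square i j) (dyck_path w) \<and>
              (\<forall>(u, v)\<in>interior (unit_square i j). u < v)}"

text \<open>A graph is a pair of a vertex set and a set of edges, each edge being the set of its two
  endvertices.\<close>

type_synonym 'a graph = "'a set \<times> 'a set set"

definition dyck_graph :: "word \<Rightarrow> nat graph" where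
  "dyck_graph w =
     (let V = {1..count_list w X}
      in (V, {{i, j} | i j. i \<in> V \<and> j \<in> V \<and> i < j \<and> (i, j) \<in> dyck_squares w}))"

definition graph_stirling :: "'a graph \<Rightarrow> nat \<Rightarrow> nat" where
  "graph_stirling G k =
     card {P. partition_on (fst G) P \<and> finite P \<and> card P = k \<and>
              (\<forall>C\<in>P. \<forall>e\<in>snd G. \<not> e \<subseteq> C)}"

end

theory Submission
  imports Defs
begin

text \<open>
  Both sides satisfy the same recurrence when a letter is put in front of a word.

  On the operator side, write \<open>e\<close> for the number of \<open>X\<close>'s minus the number of \<open>D\<close>'s in \<open>w\<close>, so
  that \<open>w = (\<Sum>k. S\<^sub>w(k) x^(e + k) D^k)\<close>.  A further multiplication by \<open>x\<close> shifts \<open>e\<close> and leaves the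
  coefficients alone, while a differentiation gives, by the product rule,
  \<open>S\<^bsub>Dw\<^esub>(k) = (e + k) S\<^sub>w(k) + S\<^sub>w(k - 1)\<close>.  The numbers \<open>normal_coeff\<close> are defined by this
  recurrence, and \<open>word_stirling_eq_normal_coeff\<close> identifies them with the Stirling numbers; the
  coefficients are unique because the functions \<open>(t - 1)^s\<close> isolate them one at a time at
  \<open>t = 1\<close>.

  On the graph side, let \<open>v\<close> be a new vertex whose neighbours form a clique \<open>N\<close> in \<open>G\<close>.  In a stable
  partition of \<open>G + v\<close> into \<open>k\<close> classes either \<open>v\<close> is alone, or it joins one of the \<open>k\<close> classes
  of a stable partition of \<open>G\<close>.  The members of \<open>N\<close> occupy \<open>card N\<close> different classes, which are
  closed to \<open>v\<close>, so that \<open>k - card N\<close> classes remain (\<open>graph_stirling_insert_simplicial\<close>).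

  The two recurrences meet in \<open>graph_stirling_dyck_suffix\<close>.  Split a Dyck word as \<open>p D s\<close>, where the
  displayed \<open>D\<close> is number \<open>i\<close>.  The Dyck path passes over column \<open>i\<close> at height \<open>c\<close>, the number of
  \<open>X\<close>'s in \<open>p\<close>, so the later neighbours of \<open>i\<close> are \<open>i + 1, \<dots>, c\<close>
  (\<open>dyck_squares_iff\<close>).  They form a clique because the path never descends, and their number
  \<open>c - i\<close> is the excess of \<open>D\<close>'s over \<open>X\<close>'s in \<open>s\<close> because the whole word is balanced.
  So prepending \<open>D\<close> to \<open>s\<close> and adding the vertex \<open>i\<close> have the same effect.

  This settles Dyck words.  For an arbitrary word, \<open>X\<close>'s in front change nothing, and \<open>b\<close> trailing
  \<open>D\<close>'s shift the index by \<open>b\<close>, since they act on the function before everything else.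
\<close>

section \<open>Normal ordering coefficients\<close>

definition excess :: "word \<Rightarrow> int" where
  "excess w = int (count_list w X) - int (count_list w D)"

fun normal_coeff :: "word \<Rightarrow> nat \<Rightarrow> int" where
  "normal_coeff [] k = (if k = 0 then 1 else 0)"
| "normal_coeff (X # w) k = normal_coeff w k"
| "normal_coeff (D # w) k =
     (excess w + int k) * normal_coeff w k + (if k = 0 then 0 else normal_coeff w (k - 1))"

lemma normal_coeff_eq_0: "length w < k \<Longrightarrow> normal_coeff w k = 0"
  by (induction w k rule: normal_coeff.induct) auto

lemma excess_simps [simp]:
  "excess [] = 0" "excess (X # w) = excess w + 1" "excess (D # w) = excess w - 1"
  by (auto simp: excess_def)

lemma smooth_on_pos_DERIV:
  assumes "smooth_on_pos f" "t > 0"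
  shows "((deriv ^^ k) f has_real_derivative (deriv ^^ Suc k) f t) (at t)"
proof -
  have "(deriv ^^ k) f differentiable_on {0<..}"
    using assms(1) by (simp add: smooth_on_pos_def)
  hence "(deriv ^^ k) f differentiable (at t)"
    using assms(2) by (simp add: differentiable_on_def at_within_open[of _ "{0<..}"])
  thus ?thesis
    by (simp add: DERIV_deriv_iff_real_differentiable)
qed

text \<open>The powers are kept in the form \<open>t powi (excess w + k)\<close> so that the product rule applies termwise
  and yields the recurrence of \<open>normal_coeff\<close>.  As \<open>deriv\<close> sees a neighbourhood of \<open>t\<close>, the induction
  hypothesis is needed for all positive arguments at once.\<close>

lemma word_op_expansion:
  assumes f: "smooth_on_pos f" and "t > 0"
  shows "word_op w f t = (\<Sum>k\<le>length w. of_int (normal_coeff w k) *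
           (t powi (excess w + int k) * (deriv ^^ k) f t))"
  using \<open>t > 0\<close>
proof (induction w arbitrary: t)
  case Nil
  then show ?case by (simp add: word_op_def)
next
  case (Cons l w)
  show ?case
  proof (cases l)
    case X
    have powi: "t powi (excess w + 1 + int k) = t * t powi (excess w + int k)" for k
      using Cons.prems by (simp add: power_int_add mult_ac)
    have "word_op (X # w) f t = (\<Sum>k\<le>length w. of_int (normal_coeff w k) *
           (t powi (excess w + 1 + int k) * (deriv ^^ k) f t))"
      using Cons.IH[OF Cons.prems]
      by (simp add: word_op_def powi sum_distrib_left mult_ac)
    thus ?thesis using X by (simp add: normal_coeff_eq_0)
  next
    case D
    define G where "G = (\<lambda>t. \<Sum>k\<le>length w. of_int (normal_coeff w k) *
           (t powi (excess w + int k) * (deriv ^^ k) f t))"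
    define T where "T = (\<lambda>k. t powi (excess w - 1 + int k) * (deriv ^^ k) f t)"
    have "(G has_real_derivative (\<Sum>k\<le>length w. of_int (normal_coeff w k) *
           (of_int (excess w + int k) * T k + T (Suc k)))) (at t)"
      unfolding G_def T_def using Cons.prems
      by (auto intro!: derivative_eq_intros smooth_on_pos_DERIV[OF f, simplified] sum.cong
            simp: algebra_simps)
    moreover have "deriv (word_op w f) t = deriv G t"
    proof (rule deriv_cong_ev)
      have "eventually (\<lambda>x. x \<in> {0<..}) (nhds t)"
        using Cons.prems by (intro eventually_nhds_in_open) auto
      thus "eventually (\<lambda>x. word_op w f x = G x) (nhds t)"
        by eventually_elim (simp add: G_def Cons.IH)
    qed simp
    ultimately have "word_op (D # w) f t = (\<Sum>k\<le>length w. of_int (normal_coeff w k) *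
           (of_int (excess w + int k) * T k + T (Suc k)))"
      by (simp add: word_op_def DERIV_imp_deriv)
    also have "\<dots> = (\<Sum>k\<le>length w. of_int (normal_coeff w k) * of_int (excess w + int k) * T k)
        + (\<Sum>k\<le>length w. of_int (normal_coeff w k) * T (Suc k))"
      by (simp add: sum.distrib algebra_simps)
    also have "(\<Sum>k\<le>length w. of_int (normal_coeff w k) * of_int (excess w + int k) * T k)
        = (\<Sum>k\<le>Suc (length w). of_int (normal_coeff w k) * of_int (excess w + int k) * T k)"
      by (simp add: normal_coeff_eq_0)
    also have "(\<Sum>k\<le>length w. of_int (normal_coeff w k) * T (Suc k))
        = (\<Sum>k\<le>Suc (length w). of_int (if k = 0 then 0 else normal_coeff w (k - 1)) * T k)"
      by (subst sum.atMost_Suc_shift) simp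
    also have "(\<Sum>k\<le>Suc (length w). of_int (normal_coeff w k) * of_int (excess w + int k) * T k) + \<dots>
        = (\<Sum>k\<le>Suc (length w). of_int (normal_coeff (D # w) k) * T k)"
      unfolding sum.distrib[symmetric] by (intro sum.cong) (auto simp: algebra_simps)
    finally show ?thesis using D by (simp add: T_def)
  qed
qed

lemma is_stirling_seq_normal_coeff: "is_stirling_seq w (normal_coeff w)"
  unfolding is_stirling_seq_def
proof (intro conjI allI impI)
  have sub: "{k. normal_coeff w k \<noteq> 0} \<subseteq> {..length w}"
    using normal_coeff_eq_0[of w] by (auto simp: not_less[symmetric])
  thus "finite {k. normal_coeff w k \<noteq> 0}"
    by (rule finite_subset) simp
  fix f and t :: real
  assume f: "smooth_on_pos f" and t: "t > 0"
  have "word_op w f t = (\<Sum>k\<le>length w. t powi excess w *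
      (of_int (normal_coeff w k) * (t ^ k * (deriv ^^ k) f t)))"
    unfolding word_op_expansion[OF f t] using t by (intro sum.cong) (auto simp: power_int_add)
  also have "\<dots> = t powi excess w *
      (\<Sum>k | normal_coeff w k \<noteq> 0. of_int (normal_coeff w k) * (t ^ k * (deriv ^^ k) f t))"
    unfolding sum_distrib_left by (rule sum.mono_neutral_right) (use sub in auto)
  finally show "word_op w f t = t powi (int (count_list w X) - int (count_list w D)) *
      (\<Sum>k | normal_coeff w k \<noteq> 0. of_int (normal_coeff w k) * (t ^ k * (deriv ^^ k) f t))"
    by (simp add: excess_def)
qed

lemma higher_deriv_shifted_power:
  fixes c :: real
  shows "(deriv ^^ k) (\<lambda>t. (t - c) ^ s) = (\<lambda>t. (\<Prod>i<k. real (s - i)) * (t - c) ^ (s - k))"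
proof (induction k)
  case (Suc k)
  have "deriv (\<lambda>t. (\<Prod>i<k. real (s - i)) * (t - c) ^ (s - k)) t
      = (\<Prod>i<Suc k. real (s - i)) * (t - c) ^ (s - Suc k)" for t
    by (rule DERIV_imp_deriv) (auto intro!: derivative_eq_intros)
  thus ?case by (simp add: Suc)
qed simp

text \<open>At \<open>t = 1\<close> the only derivative of \<open>(t - 1)^s\<close> that does not vanish is the one of order \<open>s\<close>, and the
  factors \<open>t^k\<close> equal \<open>1\<close>; hence the value of the operator determines the coefficient of index \<open>s\<close>.\<close>

lemma word_op_at_1_test_function:
  assumes "is_stirling_seq w S"
  shows "word_op w (\<lambda>t. (t - 1) ^ s) 1 = of_int (S s) * fact s"
proof -
  define f :: "real \<Rightarrow> real" where "f = (\<lambda>t. (t - 1) ^ s)"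
  have "smooth_on_pos f"
    unfolding smooth_on_pos_def f_def higher_deriv_shifted_power
    by (auto simp: differentiable_on_def intro!: derivative_intros)
  moreover have f1: "(deriv ^^ k) f 1 = (if k = s then fact s else 0)" for k
  proof (cases "k \<le> s")
    case True
    have "(\<Prod>i<s. real (s - i)) = fact s"
      by (simp add: fact_prod_rev atLeast0LessThan)
    thus ?thesis using True by (auto simp: f_def higher_deriv_shifted_power power_0_left)
  next
    case False
    hence "(\<Prod>i<k. real (s - i)) = 0" by (intro prod_zero) (auto intro!: bexI[of _ s])
    thus ?thesis using False by (auto simp: f_def higher_deriv_shifted_power)
  qed
  ultimately have "word_op w f 1 = (\<Sum>k | S k \<noteq> 0. of_int (S k) * (if k = s then fact s else 0))"
    using assms by (simp add: is_stirling_seq_def)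
  also have "\<dots> = (\<Sum>k | S k \<noteq> 0. if k = s then of_int (S s) * fact s else 0)"
    by (intro sum.cong) auto
  also have "\<dots> = of_int (S s) * fact s"
    using assms by (subst sum.delta) (auto simp: is_stirling_seq_def)
  finally show ?thesis by (simp add: f_def)
qed

lemma word_stirling_eq_normal_coeff: "word_stirling w = normal_coeff w"
  unfolding word_stirling_def
proof (rule the_equality, rule is_stirling_seq_normal_coeff)
  fix S assume "is_stirling_seq w S"
  show "S = normal_coeff w"
  proof
    fix s
    have "of_int (S s) * fact s = (of_int (normal_coeff w s) * fact s :: real)"
      using word_op_at_1_test_function[OF \<open>is_stirling_seq w S\<close>, of s]
        word_op_at_1_test_function[OF is_stirling_seq_normal_coeff, of w s] by simp
    thus "S s = normal_coeff w s" by simp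
  qed
qed

text \<open>Trailing \<open>D\<close>'s lower the excess by \<open>b\<close> and raise the index by \<open>b\<close>, so the factor
  \<open>excess w + int k\<close> in the recurrence keeps its value.\<close>

lemma normal_coeff_append_Ds:
  "normal_coeff (w @ replicate b D) k = (if k < b then 0 else normal_coeff w (k - b))"
proof (induction w arbitrary: k)
  case Nil
  have [simp]: "excess (replicate b D) = - int b" for b
    by (induction b) auto
  show ?case
    by (induction b arbitrary: k) (auto simp: Suc_diff_le)
next
  case (Cons l w)
  have [simp]: "excess (w @ replicate b D) = excess w - int b"
    by (induction b) (auto simp: excess_def)
  show ?case
    by (cases l) (auto simp: Cons)
qed

lemma normal_coeff_Xs_append: "normal_coeff (replicate a X @ w) = normal_coeff w"
  by (induction a) auto

section \<open>Adding a vertex with complete neighbourhood to a graph\<close>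

definition stable_partitions :: "'a set \<Rightarrow> 'a set set \<Rightarrow> nat \<Rightarrow> 'a set set set" where
  "stable_partitions V E k =
     {P. partition_on V P \<and> finite P \<and> card P = k \<and> (\<forall>C\<in>P. \<forall>e\<in>E. \<not> e \<subseteq> C)}"

lemma graph_stirling_eq: "graph_stirling (V, E) k = card (stable_partitions V E k)"
  by (simp add: graph_stirling_def stable_partitions_def)

lemma finite_stable_partitions: "finite V \<Longrightarrow> finite (stable_partitions V E k)"
  by (rule finite_subset[OF _ finitely_many_partition_on]) (auto simp: stable_partitions_def)

lemma partition_on_unique_block:
  "partition_on V P \<Longrightarrow> A \<in> P \<Longrightarrow> B \<in> P \<Longrightarrow> x \<in> A \<Longrightarrow> x \<in> B \<Longrightarrow> A = B"
  by (auto simp: partition_on_def disjoint_def)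

text \<open>Mapping each clique vertex to its block is injective, since a block contains no edge; its image
  is the set of blocks that meet the clique.\<close>

lemma card_blocks_avoiding_clique:
  assumes P: "P \<in> stable_partitions V E k" and "N \<subseteq> V"
    and clique: "\<And>x y. x \<in> N \<Longrightarrow> y \<in> N \<Longrightarrow> x \<noteq> y \<Longrightarrow> {x, y} \<in> E"
  shows "int (card {C\<in>P. C \<inter> N = {}}) = int k - int (card N)"
proof -
  have part: "partition_on V P" and fin: "finite P" and k: "card P = k"
    and stable: "\<And>C e. C \<in> P \<Longrightarrow> e \<in> E \<Longrightarrow> \<not> e \<subseteq> C"
    using P by (auto simp: stable_partitions_def)
  have "\<exists>C. C \<in> P \<and> x \<in> C" if "x \<in> N" for x
    using part that \<open>N \<subseteq> V\<close> by (auto simp: partition_on_def)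
  then obtain blk where blk: "\<And>x. x \<in> N \<Longrightarrow> blk x \<in> P \<and> x \<in> blk x" by metis
  have "bij_betw blk N {C\<in>P. C \<inter> N \<noteq> {}}"
    unfolding bij_betw_def
  proof
    show "inj_on blk N"
    proof (rule inj_onI, rule ccontr)
      fix x y assume "x \<in> N" "y \<in> N" "blk x = blk y" "x \<noteq> y"
      thus False using stable[of "blk x" "{x, y}"] clique[of x y] blk by auto
    qed
    show "blk ` N = {C\<in>P. C \<inter> N \<noteq> {}}"
      using blk partition_on_unique_block[OF part] by (fastforce simp: image_iff)
  qed
  hence "card {C\<in>P. C \<inter> N \<noteq> {}} = card N" by (simp add: bij_betw_same_card)
  moreover have "card {C\<in>P. C \<inter> N \<noteq> {}} + card {C\<in>P. C \<inter> N = {}} = card P"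
    using fin by (subst card_Un_disjoint[symmetric]) (auto intro!: arg_cong[of _ _ card])
  ultimately show ?thesis using k by simp
qed

text \<open>Removing the block \<open>{v}\<close> is inverse to adding it.  A block \<open>{v}\<close> contains no edge because the
  edges are proper pairs.\<close>

lemma card_stable_partitions_singleton_block:
  assumes v: "v \<notin> V" and edges: "\<And>e. e \<in> E \<Longrightarrow> \<exists>x y. x \<noteq> y \<and> e = {x, y}"
  shows "card {P \<in> stable_partitions (insert v V) E (Suc k). {v} \<in> P}
    = card (stable_partitions V E k)"
proof -
  have notin: "C \<subseteq> V" if "P \<in> stable_partitions V E j" "C \<in> P" for P C j
    using that by (auto simp: stable_partitions_def partition_on_def)
  have "bij_betw (insert {v}) (stable_partitions V E k)
      {P \<in> stable_partitions (insert v V) E (Suc k). {v} \<in> P}"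
  proof (rule bij_betw_byWitness[where f' = "\<lambda>P. P - {{v}}"])
    show "\<forall>P\<in>stable_partitions V E k. insert {v} P - {{v}} = P"
      using notin v by blast
    show "insert {v} ` stable_partitions V E k
        \<subseteq> {P \<in> stable_partitions (insert v V) E (Suc k). {v} \<in> P}"
    proof safe
      fix P assume P: "P \<in> stable_partitions V E k"
      have nv: "{v} \<notin> P" and dj: "disjnt {v} (\<Union>P)"
        using notin[OF P] v by (auto simp: disjnt_def)
      have "insert v V - {v} = V" using v by auto
      hence "partition_on (insert v V) (insert {v} P)"
        using P dj by (simp add: partition_on_insert stable_partitions_def)
      moreover have "\<not> e \<subseteq> {v}" if "e \<in> E" for e
        using edges[OF that] by auto
      ultimately show "insert {v} P \<in> stable_partitions (insert v V) E (Suc k)"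
        using P nv by (auto simp: stable_partitions_def)
    qed
    show "(\<lambda>P. P - {{v}}) ` {P \<in> stable_partitions (insert v V) E (Suc k). {v} \<in> P}
        \<subseteq> stable_partitions V E k"
    proof safe
      fix P assume P: "P \<in> stable_partitions (insert v V) E (Suc k)" "{v} \<in> P"
      have part: "partition_on (insert v V) P" using P by (simp add: stable_partitions_def)
      have dj: "disjnt {v} (\<Union>(P - {{v}}))"
        using partition_on_unique_block[OF part _ P(2), of _ v] by (auto simp: disjnt_def)
      have "partition_on (insert v V) (insert {v} (P - {{v}}))"
        using part P(2) by (simp add: insert_absorb)
      hence "partition_on (insert v V - {v}) (P - {{v}})"
        using partition_on_insert[OF dj] by simp
      moreover have "insert v V - {v} = V" using v by auto
      ultimately show "P - {{v}} \<in> stable_partitions V E k"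
        using P by (auto simp: stable_partitions_def card_Diff_singleton)
    qed
  qed auto
  thus ?thesis by (simp add: bij_betw_same_card)
qed

text \<open>A partition in which \<open>v\<close> has company arises from exactly one partition of \<open>V\<close> together with the
  block that \<open>v\<close> joins, and that block has to avoid the neighbours of \<open>v\<close>.\<close>

lemma card_stable_partitions_joined_block:
  assumes V: "finite V" and v: "v \<notin> V"
    and edges: "\<And>e. e \<in> E \<Longrightarrow> \<exists>x y. x \<noteq> y \<and> e = {x, y}"
  shows "card {P \<in> stable_partitions (insert v V) E k. {v} \<notin> P}
    = (\<Sum>P\<in>stable_partitions V E k. card {C\<in>P. C \<inter> {u\<in>V. {v, u} \<in> E} = {}})"
proof -
  define N where "N = {u\<in>V. {v, u} \<in> E}"
  define dom where "dom = (SIGMA P:stable_partitions V E k. {C\<in>P. C \<inter> N = {}})"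
  define join where "join = (\<lambda>(P, C). insert (insert v C) (P - {C}))"
  have sub: "C \<subseteq> V" if "P \<in> stable_partitions V E j" "C \<in> P" for P C j
    using that by (auto simp: stable_partitions_def partition_on_def)
  have fin: "finite P" if "P \<in> stable_partitions V E k" for P
    using that by (simp add: stable_partitions_def)
  have "inj_on join dom"
  proof (rule inj_onI, clarsimp)
    fix P C P' C'
    assume "(P, C) \<in> dom" "(P', C') \<in> dom" and eq: "join (P, C) = join (P', C')"
    hence P: "P \<in> stable_partitions V E k" "C \<in> P" and P': "P' \<in> stable_partitions V E k" "C' \<in> P'"
      by (auto simp: dom_def)
    note s = sub[OF P(1)] sub[OF P'(1)]
    have nv: "v \<notin> B" if "B \<in> P \<union> P'" for B using s that v by blast
    have "insert v C \<in> join (P', C')" using eq by (auto simp: join_def)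
    hence "insert v C = insert v C'" using nv by (auto simp: join_def)
    hence C: "C = C'" using nv P(2) P'(2) by (metis UnI1 UnI2 insert_ident)
    have "P - {C} = {B \<in> join (P, C). v \<notin> B}" "P' - {C'} = {B \<in> join (P', C'). v \<notin> B}"
      using nv by (auto simp: join_def)
    hence "P - {C} = P' - {C'}" using eq by simp
    thus "P = P' \<and> C = C'" using C P(2) P'(2) by blast
  qed
  moreover have "join ` dom = {P \<in> stable_partitions (insert v V) E k. {v} \<notin> P}"
  proof (intro equalityI subsetI)
    fix Q assume "Q \<in> join ` dom"
    then obtain P C where Q: "Q = insert (insert v C) (P - {C})"
      and P: "P \<in> stable_partitions V E k" "C \<in> P" and CN: "C \<inter> N = {}"
      by (auto simp: dom_def join_def)
    have part: "partition_on V P" and stable: "\<And>C e. C \<in> P \<Longrightarrow> e \<in> E \<Longrightarrow> \<not> e \<subseteq> C"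
      and fP: "finite P" and cP: "card P = k"
      using P(1) by (auto simp: stable_partitions_def)
    have C: "C \<noteq> {}" "C \<subseteq> V" using part P(2) by (auto simp: partition_on_def)
    have djC: "disjnt C (\<Union>(P - {C}))"
      using partition_on_unique_block[OF part _ P(2)] by (auto simp: disjnt_iff)
    have "partition_on V (insert C (P - {C}))" using part P(2) by (simp add: insert_absorb)
    hence "partition_on (V - C) (P - {C})" using partition_on_insert[OF djC] by simp
    moreover have "insert v V - insert v C = V - C" using v by auto
    moreover have "disjnt (insert v C) (\<Union>(P - {C}))"
      using djC sub[OF P(1)] v by (auto simp: disjnt_iff)
    ultimately have "partition_on (insert v V) Q"
      unfolding Q using C by (subst partition_on_insert) auto
    moreover have "\<not> e \<subseteq> insert v C" if e: "e \<in> E" for e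
    proof
      assume le: "e \<subseteq> insert v C"
      obtain x y where xy: "x \<noteq> y" "e = {x, y}" using edges[OF e] by blast
      have "v \<in> e" using stable[OF P(2) e] le by auto
      then obtain u where u: "u \<noteq> v" "e = {v, u}" using xy by (metis doubleton_eq_iff insertE singletonD)
      hence "u \<in> C" using le by auto
      thus False using u e C CN by (auto simp: N_def)
    qed
    moreover have "insert v C \<notin> P" using sub[OF P(1)] v by auto
    hence "finite Q \<and> card Q = k" unfolding Q using fP cP P(2)
      by (metis DiffD1 card_insert_disjoint card_Suc_Diff1 finite_Diff finite_insert)
    moreover have "insert v C \<noteq> {v}" using C v by auto
    hence "{v} \<notin> Q" unfolding Q using sub[OF P(1)] v by auto
    ultimately show "Q \<in> {P \<in> stable_partitions (insert v V) E k. {v} \<notin> P}"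
      using stable by (auto simp: stable_partitions_def Q)
  next
    fix Q assume Q: "Q \<in> {P \<in> stable_partitions (insert v V) E k. {v} \<notin> P}"
    hence part: "partition_on (insert v V) Q" and stable: "\<And>C e. C \<in> Q \<Longrightarrow> e \<in> E \<Longrightarrow> \<not> e \<subseteq> C"
      and fQ: "finite Q" and cQ: "card Q = k" and nv: "{v} \<notin> Q"
      by (auto simp: stable_partitions_def)
    obtain B where B: "B \<in> Q" "v \<in> B" using part by (auto simp: partition_on_def)
    define C where "C = B - {v}"
    define P where "P = insert C (Q - {B})"
    have BC: "B = insert v C" using B by (auto simp: C_def)
    have ne: "C \<noteq> {}" using nv B BC by auto
    have djB: "disjnt B (\<Union>(Q - {B}))"
      using partition_on_unique_block[OF part _ B(1)] by (auto simp: disjnt_iff)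
    have "partition_on (insert v V) (insert B (Q - {B}))" using part B by (simp add: insert_absorb)
    hence rest: "partition_on (insert v V - B) (Q - {B})" and BV: "B \<subseteq> insert v V"
      using partition_on_insert[OF djB] by auto
    have CV: "C \<subseteq> V" using BV by (auto simp: C_def)
    have "insert v V - B = V - C" using v B by (auto simp: C_def)
    moreover have djC: "disjnt C (\<Union>(Q - {B}))"
      using djB by (auto simp: C_def disjnt_iff)
    ultimately have "partition_on V P"
      unfolding P_def using rest ne CV by (subst partition_on_insert) auto
    moreover have CQ: "C \<notin> Q - {B}" using djC ne by (auto simp: disjnt_def)
    hence "finite P \<and> card P = k" unfolding P_def using fQ cQ B(1)
      by (metis card_insert_disjoint card_Suc_Diff1 finite_Diff finite_insert)
    moreover have "\<not> e \<subseteq> C" if "e \<in> E" for e using stable[OF B(1) that] by (auto simp: C_def)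
    ultimately have P: "P \<in> stable_partitions V E k"
      using stable by (auto simp: stable_partitions_def P_def)
    have "C \<inter> N = {}"
      using stable[OF B(1)] B(2) by (auto simp: N_def C_def)
    hence "(P, C) \<in> dom" using P by (auto simp: dom_def P_def)
    moreover have "join (P, C) = Q"
      using CQ B BC by (auto simp: join_def P_def)
    ultimately show "Q \<in> join ` dom" by force
  qed
  ultimately have "card {P \<in> stable_partitions (insert v V) E k. {v} \<notin> P} = card dom"
    by (metis card_image)
  also have "\<dots> = (\<Sum>P\<in>stable_partitions V E k. card {C\<in>P. C \<inter> N = {}})"
    unfolding dom_def using V fin by (subst card_SigmaI) (auto simp: finite_stable_partitions)
  finally show ?thesis by (simp add: N_def)
qed

text \<open>The difference \<open>int k - int (card N)\<close> is negative for small \<open>k\<close>.  This is harmless: the vertices of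
  the clique \<open>N\<close> lie in different blocks, so the graph then has no stable partition into \<open>k\<close>
  blocks.\<close>

lemma graph_stirling_insert_simplicial:
  assumes V: "finite V" and v: "v \<notin> V"
    and edges: "\<And>e. e \<in> E \<Longrightarrow> \<exists>x y. x \<noteq> y \<and> e = {x, y}"
    and N: "{u\<in>V. {v, u} \<in> E} = N"
    and clique: "\<And>x y. x \<in> N \<Longrightarrow> y \<in> N \<Longrightarrow> x \<noteq> y \<Longrightarrow> {x, y} \<in> E"
  shows "int (graph_stirling (insert v V, E) k) =
    (int k - int (card N)) * int (graph_stirling (V, E) k) +
    (if k = 0 then 0 else int (graph_stirling (V, E) (k - 1)))"
proof -
  let ?Q = "stable_partitions (insert v V) E k"
  have "card ?Q = card {P \<in> ?Q. {v} \<notin> P} + card {P \<in> ?Q. {v} \<in> P}"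
    using finite_stable_partitions[of "insert v V" E k] V
    by (subst card_Un_disjoint[symmetric]) (auto intro!: arg_cong[of _ _ card])
  moreover have "card {P \<in> ?Q. {v} \<in> P} =
      (if k = 0 then 0 else card (stable_partitions V E (k - 1)))"
  proof (cases k)
    case 0
    have "{v} \<notin> P" if "P \<in> stable_partitions (insert v V) E 0" for P
      using that by (auto simp: stable_partitions_def)
    hence empty: "{P \<in> stable_partitions (insert v V) E 0. {v} \<in> P} = {}" by blast
    show ?thesis unfolding 0 empty by simp
  next
    case (Suc j)
    thus ?thesis using card_stable_partitions_singleton_block[OF v edges, of E j] by simp
  qed
  moreover have "int (card {P \<in> ?Q. {v} \<notin> P}) =
      (\<Sum>P\<in>stable_partitions V E k. int (card {C\<in>P. C \<inter> N = {}}))"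
    using card_stable_partitions_joined_block[OF V v edges, of E k] by (simp add: N)
  moreover have "\<dots> = (\<Sum>P\<in>stable_partitions V E k. int k - int (card N))"
    using N by (intro sum.cong refl card_blocks_avoiding_clique[OF _ _ clique]) auto
  ultimately show ?thesis by (simp add: graph_stirling_eq)
qed

section \<open>Unit squares below a Dyck path\<close>

lemma count_list_replicate: "count_list (replicate m a) b = (if a = b then m else 0)"
  by (induction m) auto

lemma count_list_take_mono: "i \<le> j \<Longrightarrow> count_list (take i w) a \<le> count_list (take j w) a"
  by (metis count_list_append le_add1 le_add_diff_inverse take_add)

lemma count_list_take_Suc:
  "i < length w \<Longrightarrow> count_list (take (Suc i) w) a = count_list (take i w) a + (if w ! i = a then 1 else 0)"
  by (simp add: take_Suc_conv_app_nth)

lemma position_of_nth_occurrence: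
  assumes "i < length w" "j < length w" "w ! i = a" "w ! j = a"
    and "count_list (take i w) a = count_list (take j w) a"
  shows "i = j"
proof (rule ccontr)
  assume "i \<noteq> j"
  then consider "Suc i \<le> j" | "Suc j \<le> i" by linarith
  thus False
    using count_list_take_mono[of "Suc i" j w a] count_list_take_mono[of "Suc j" i w a]
      count_list_take_Suc[of i w a] count_list_take_Suc[of j w a] assms by cases auto
qed

lemma interior_unit_square_above_diagonal:
  "(\<forall>(u, v)\<in>interior (unit_square i j). u < v) \<longleftrightarrow> i < j"
proof
  assume "\<forall>(u, v)\<in>interior (unit_square i j). u < v"
  moreover have "(real i - 1/2, real j - 1/2) \<in> interior (unit_square i j)"
    by (simp add: unit_square_def interior_Times)
  ultimately show "i < j" by auto
next
  assume "i < j"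
  thus "\<forall>(u, v)\<in>interior (unit_square i j). u < v"
    by (auto simp: unit_square_def interior_Times)
qed

lemma closed_segment_horizontal:
  "a \<le> b \<Longrightarrow> closed_segment (a, c) (b, c) = {a..b} \<times> {c :: real}" for a b :: real
proof -
  assume "a \<le> b"
  have "closed_segment (a, c) (b, c) = (\<lambda>t. (t, c)) ` closed_segment a b"
    unfolding closed_segment_def by (force simp: algebra_simps)
  thus ?thesis using \<open>a \<le> b\<close> by (auto simp: closed_segment_eq_real_ivl)
qed

text \<open>Column \<open>i\<close> is crossed by a single horizontal step, the one of the \<open>i\<close>-th \<open>D\<close>, at height
  \<open>count_list p X\<close>.  Therefore a square of the column lies below the path iff its top edge does.\<close>

lemma dyck_squares_iff:
  assumes w: "w = p @ D # s"
  shows "(Suc (count_list p D), j) \<in> dyck_squares w \<longleftrightarrow>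
    Suc (count_list p D) < j \<and> j \<le> count_list p X"
proof -
  define d c where "d = count_list p D" and "c = count_list p X"
  have seg: "closed_segment (dyck_vertex w (length p)) (dyck_vertex w (Suc (length p)))
      = {real d..real d + 1} \<times> {real c}"
    using closed_segment_horizontal[of "real d" "real d + 1" "real c"]
    by (simp add: w dyck_vertex_def d_def c_def add.commute)
  have "below_path (unit_square (Suc d) j) (dyck_path w) \<longleftrightarrow> j \<le> c"
  proof
    assume "j \<le> c"
    show "below_path (unit_square (Suc d) j) (dyck_path w)"
      unfolding below_path_def
    proof clarify
      fix u v assume uv: "(u, v) \<in> unit_square (Suc d) j"
      have "(u, real c) \<in> dyck_path w"
        unfolding dyck_path_def
      proof (rule insertI2, rule UN_I)
        show "length p \<in> {..<length w}" by (simp add: w)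
        show "(u, real c) \<in> closed_segment (dyck_vertex w (length p)) (dyck_vertex w (Suc (length p)))"
          using uv unfolding seg by (auto simp: unit_square_def)
      qed
      thus "\<exists>v'\<ge>v. (u, v') \<in> dyck_path w"
        using uv \<open>j \<le> c\<close> by (intro exI[of _ "real c"]) (auto simp: unit_square_def)
    qed
  next
    assume below: "below_path (unit_square (Suc d) j) (dyck_path w)"
    have "(real d + 1/2, real j) \<in> unit_square (Suc d) j" by (simp add: unit_square_def)
    then obtain v' where v': "v' \<ge> real j" "(real d + 1/2, v') \<in> dyck_path w"
      using below by (auto simp: below_path_def)
    \<comment> \<open>Vertical steps have integral abscissae, so the path meets the vertical line through the
      middle of the square only within the step of the \<open>D\<close> after \<open>p\<close>.\<close>
    have half: "real d + 1/2 \<noteq> real e" for e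
    proof
      assume "real d + 1/2 = real e"
      hence "real (2 * d + 1) = real (2 * e)" by simp
      hence "2 * d + 1 = 2 * e" by (simp only: of_nat_eq_iff)
      thus False by presburger
    qed
    have "(real d + 1/2, v') \<noteq> dyck_vertex w 0" using half[of 0] by (simp add: dyck_vertex_def)
    then obtain l where l: "l < length w"
      "(real d + 1/2, v') \<in> closed_segment (dyck_vertex w l) (dyck_vertex w (Suc l))"
      using v'(2) by (auto simp: dyck_path_def)
    define dl cl where "dl = count_list (take l w) D" and "cl = count_list (take l w) X"
    show "j \<le> c"
    proof (cases "w ! l")
      case X
      hence "dyck_vertex w (Suc l) = (real dl, real cl + 1)" "dyck_vertex w l = (real dl, real cl)"
        using l(1) by (auto simp: dyck_vertex_def count_list_take_Suc dl_def cl_def)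
      hence "real d + 1/2 = real dl"
        using l(2) by (auto simp: closed_segment_def algebra_simps)
      thus ?thesis using half by blast
    next
      case D
      hence "dyck_vertex w (Suc l) = (real dl + 1, real cl)" "dyck_vertex w l = (real dl, real cl)"
        using l(1) by (auto simp: dyck_vertex_def count_list_take_Suc dl_def cl_def)
      hence eq: "real dl \<le> real d + 1/2" "real d + 1/2 \<le> real dl + 1" "v' = real cl"
        using l(2) by (auto simp: closed_segment_horizontal)
      hence "dl = d" using half[of dl] half[of "Suc dl"] by linarith
      hence "l = length p"
        using l(1) D by (intro position_of_nth_occurrence[of l w "length p" D]) (auto simp: w dl_def d_def)
      thus ?thesis using eq v' by (simp add: cl_def c_def w)
    qed
  qed
  thus ?thesis
    by (simp add: dyck_squares_def interior_unit_square_above_diagonal d_def c_def)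
      blast
qed

section \<open>Dyck words\<close>

lemma prefix_nonneg_append_left:
  "prefix_nonneg (p @ s) \<Longrightarrow> count_list p D \<le> count_list p X"
  unfolding prefix_nonneg_def by (drule spec[of _ "length p"]) simp

lemma split_at_nth_occurrence:
  assumes "m < count_list w a"
  obtains p s where "w = p @ a # s" "count_list p a = m"
proof -
  have "\<exists>p s. w = p @ a # s \<and> count_list p a = m"
    using assms
  proof (induction w arbitrary: m)
    case (Cons b w)
    show ?case
    proof (cases "b = a \<and> m = 0")
      case True
      hence "b # w = [] @ a # w" "count_list [] a = m" by auto
      thus ?thesis by blast
    next
      case False
      define m' where "m' = (if b = a then m - 1 else m)"
      have "m' < count_list w a" using Cons.prems False by (auto simp: m'_def split: if_splits)
      then obtain p s where "w = p @ a # s" "count_list p a = m'" using Cons.IH by blast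
      thus ?thesis using False by (intro exI[of _ "b # p"] exI[of _ s]) (auto simp: m'_def)
    qed
  qed simp
  thus ?thesis using that by blast
qed

lemma dyck_graph_edge_iff:
  assumes w: "w = p @ D # s" "dyck_word w" and ij: "i = Suc (count_list p D)" "i < j"
  shows "{i, j} \<in> snd (dyck_graph w) \<longleftrightarrow> j \<le> count_list p X"
proof -
  have "{i, j} \<in> snd (dyck_graph w) \<longleftrightarrow> i \<in> {1..count_list w X} \<and> j \<in> {1..count_list w X} \<and>
      (i, j) \<in> dyck_squares w"
    (is "_ \<longleftrightarrow> ?R")
  proof
    assume "{i, j} \<in> snd (dyck_graph w)"
    thus ?R using ij(2) by (auto simp: dyck_graph_def Let_def doubleton_eq_iff)
  next
    assume ?R
    thus "{i, j} \<in> snd (dyck_graph w)"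
      unfolding dyck_graph_def Let_def snd_conv using ij(2) by blast
  qed
  also have "\<dots> \<longleftrightarrow> j \<le> count_list p X"
    using w ij dyck_squares_iff[OF w(1), of j] by (auto simp: dyck_word_def)
  finally show ?thesis .
qed

text \<open>Reading the word from the right, every \<open>D\<close> contributes the vertex of its column, so a suffix
  corresponds to the subgraph on the last vertices.  The edge set of the whole graph can stay:
  edges leaving the vertex set are contained in no block of a partition.\<close>

lemma graph_stirling_dyck_suffix:
  assumes "dyck_word v" and "v = p @ s"
  shows "int (graph_stirling ({count_list p D<..count_list v X}, snd (dyck_graph v)) k)
    = normal_coeff s k"
  using assms(2)
proof (induction s arbitrary: p k)
  case Nil
  have "count_list p D = count_list v X" using assms(1) Nil by (simp add: dyck_word_def)
  moreover have "stable_partitions {} E k = (if k = 0 then {{}} else {})" for E :: "nat set set"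
    by (auto simp: stable_partitions_def partition_on_empty)
  ultimately show ?case
    by (simp add: graph_stirling_eq)
next
  case (Cons l s)
  show ?case
  proof (cases l)
    case X
    thus ?thesis using Cons.IH[of "p @ [X]" k] Cons.prems by simp
  next
    case D
    define n i c where "n = count_list v X" and "i = count_list p D" and "c = count_list p X"
    define E where "E = snd (dyck_graph v)"
    have v: "v = p @ D # s" using Cons.prems D by simp
    have n: "n = c + count_list s X" "n = Suc i + count_list s D"
      using assms(1) v by (auto simp: n_def c_def i_def dyck_word_def)
    have "Suc i \<le> c"
      using assms(1) prefix_nonneg_append_left[of "p @ [D]" s] v
      by (simp add: dyck_word_def i_def c_def)
    have IH: "int (graph_stirling ({Suc i<..n}, E) k) = normal_coeff s k" for k
      using Cons.IH[of "p @ [D]" k] v by (simp add: i_def n_def E_def)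
    have N: "{u \<in> {Suc i<..n}. {Suc i, u} \<in> E} = {Suc i<..c}"
      using dyck_graph_edge_iff[OF v assms(1), of "Suc i"] n
      by (auto simp: E_def i_def c_def)
    \<comment> \<open>Column \<open>x\<close> is crossed later than column \<open>Suc i\<close>, hence at height at least \<open>c\<close>.\<close>
    have lt: "{x, y} \<in> E" if "Suc i < x" "x < y" "y \<le> c" for x y
    proof -
      have "x - 1 < count_list v D" using that n assms(1) by (simp add: n_def dyck_word_def)
      then obtain p' s' where v': "v = p' @ D # s'" and x: "count_list p' D = x - 1"
        by (rule split_at_nth_occurrence)
      have "length p \<le> length p'"
      proof (rule ccontr)
        assume "\<not> ?thesis"
        hence "count_list (take (length p') v) D \<le> count_list (take (length p) v) D"
          by (intro count_list_take_mono) simp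
        hence "count_list p' D \<le> count_list p D" using v v' by (metis append_eq_conv_conj)
        thus False using x that by (simp add: i_def)
      qed
      hence "count_list (take (length p) v) X \<le> count_list (take (length p') v) X"
        by (intro count_list_take_mono) simp
      hence "c \<le> count_list p' X" using v v' by (metis append_eq_conv_conj c_def)
      thus ?thesis
        using dyck_graph_edge_iff[OF v' assms(1), of x y] x that by (simp add: E_def)
    qed
    have clique: "{x, y} \<in> E" if "x \<in> {Suc i<..c}" "y \<in> {Suc i<..c}" "x \<noteq> y" for x y
      using lt[of x y] lt[of y x] that by (cases "x < y") (auto simp: insert_commute)
    have edges: "\<exists>x y. x \<noteq> y \<and> e = {x, y}" if "e \<in> E" for e
    proof -
      from that obtain x y where "e = {x, y}" "x < y"
        unfolding E_def dyck_graph_def Let_def snd_conv by blast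
      thus ?thesis using less_imp_neq by blast
    qed
    have ins: "{i<..n} = insert (Suc i) {Suc i<..n}" using n by auto
    have excess: "int (card {Suc i<..c}) = - excess s"
      using \<open>Suc i \<le> c\<close> n by (simp add: excess_def)
    have "int (graph_stirling ({i<..n}, E) k) = (int k + excess s) * normal_coeff s k +
        (if k = 0 then 0 else normal_coeff s (k - 1))"
      unfolding ins by (subst graph_stirling_insert_simplicial[OF _ _ edges N clique])
        (auto simp only: excess IH diff_minus_eq_add finite_greaterThanAtMost
          greaterThanAtMost_iff less_irrefl)
    thus ?thesis using D by (simp add: n_def E_def i_def add.commute)
  qed
qed

lemma dyck_word_stirling:
  assumes "dyck_word v"
  shows "int (graph_stirling (dyck_graph v) k) = normal_coeff v k"
proof -
  have "dyck_graph v = ({0<..count_list v X}, snd (dyck_graph v))"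
    by (auto simp: dyck_graph_def Let_def)
  thus ?thesis using graph_stirling_dyck_suffix[OF assms, of "[]" v k] by simp
qed

text \<open>As many leading \<open>X\<close>'s as \<open>w\<close> has letters make all prefixes nonnegative, so the least \<open>a\<close>
  exists; then \<open>b\<close> is forced by balance, and the trailing \<open>D\<close>'s descend to balance only
  at the end.\<close>

lemma dyck_word_assoc_dyck_word: "dyck_word (assoc_dyck_word w)"
proof -
  define u where "u = replicate (assoc_a w) X @ w"
  have "prefix_nonneg (replicate (length w) X @ w)"
    unfolding prefix_nonneg_def
  proof (intro allI impI)
    fix i
    show "count_list (take i (replicate (length w) X @ w)) D
        \<le> count_list (take i (replicate (length w) X @ w)) X"
      using count_le_length[of "take (i - length w) w" D]
      by (cases "i \<le> length w") (auto simp: count_list_replicate min_def split: if_splits)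
  qed
  hence u: "prefix_nonneg u"
    unfolding u_def assoc_a_def by (rule LeastI)
  hence le: "count_list u D \<le> count_list u X"
    using prefix_nonneg_append_left[of u "[]"] by simp
  define b where "b = count_list u X - count_list u D"
  have "prefix_nonneg (u @ replicate b D)"
    unfolding prefix_nonneg_def
  proof (intro allI impI)
    fix i
    show "count_list (take i (u @ replicate b D)) D \<le> count_list (take i (u @ replicate b D)) X"
      using u le by (cases "i \<le> length u") (auto simp: prefix_nonneg_def count_list_replicate b_def)
  qed
  hence "dyck_word (u @ replicate b D)" using le by (simp add: dyck_word_def count_list_replicate b_def)
  moreover have "b' = b" if "dyck_word (u @ replicate b' D)" for b'
    using that by (simp add: dyck_word_def count_list_replicate b_def)
  ultimately have "dyck_word (u @ replicate (THE b. dyck_word (u @ replicate b D)) D)"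
    by (rule theI)
  thus ?thesis by (simp add: assoc_dyck_word_def assoc_b_def u_def)
qed

theorem corollary2p9:
  fixes w :: word and k :: nat
  shows "word_stirling w k = int (graph_stirling (dyck_graph (assoc_dyck_word w)) (k + assoc_b w))"
proof -
  have "int (graph_stirling (dyck_graph (assoc_dyck_word w)) (k + assoc_b w))
      = normal_coeff (assoc_dyck_word w) (k + assoc_b w)"
    by (rule dyck_word_stirling[OF dyck_word_assoc_dyck_word])
  also have "\<dots> = normal_coeff w k"
    by (simp add: assoc_dyck_word_def normal_coeff_Xs_append normal_coeff_append_Ds)
  finally show ?thesis by (simp add: word_stirling_eq_normal_coeff)
qed

end
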